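(* If $G$ is a connected graph with $\operatorname{im}(G)<\operatorname{reg}(G)=\operatorname{m}(G)$, then $G$ is isomorphic to the $5$-cycle $C_5$.
   Context: $\operatorname{reg}(G)=\max\{j\ge0:\widetilde H_{j-1}(\operatorname{Ind}(G[S]);\Bbbk)\neq0\text{ for some }S\subseteq V(G)\}$ over a fixed field $\Bbbk$ ($\operatorname{Ind}$ = independence complex). $\operatorname{im}(G)$ is the induced matching number and $\operatorname{m}(G)$ the matching number (maximum number of pairwise vertex-disjoint edges). *)

theory Defs
  imports Main
begin

definition simple_graph :: "'a set \<Rightarrow> 'a set set \<Rightarrow> bool" where
  "simple_graph V E \<longleftrightarrow> finite V \<and> (\<forall>e\<in>E. e \<subseteq> V \<and> card e = 2)"

definition adj :: "'a set set \<Rightarrow> 'a \<Rightarrow> 'a \<Rightarrow> bool" where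
  "adj E u v \<longleftrightarrow> {u, v} \<in> E"

definition connected_graph :: "'a set \<Rightarrow> 'a set set \<Rightarrow> bool" where
  "connected_graph V E \<longleftrightarrow> V \<noteq> {} \<and>
     (\<forall>u\<in>V. \<forall>v\<in>V. (\<lambda>x y. x \<in> V \<and> y \<in> V \<and> adj E x y)\<^sup>*\<^sup>* u v)"

definition is_matching :: "'a set set \<Rightarrow> 'a set set \<Rightarrow> bool" where
  "is_matching E M \<longleftrightarrow> M \<subseteq> E \<and> (\<forall>e\<in>M. \<forall>f\<in>M. e \<noteq> f \<longrightarrow> e \<inter> f = {})"

definition is_induced_matching :: "'a set set \<Rightarrow> 'a set set \<Rightarrow> bool" where
  "is_induced_matching E M \<longleftrightarrow> is_matching E M \<and> (\<forall>e\<in>E. e \<subseteq> \<Union>M \<longrightarrow> e \<in> M)"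

definition matching_number :: "'a set set \<Rightarrow> nat" where
  "matching_number E = Max (card ` {M. is_matching E M})"

definition induced_matching_number :: "'a set set \<Rightarrow> nat" where
  "induced_matching_number E = Max (card ` {M. is_induced_matching E M})"

text \<open>A simplicial complex is a set of finite vertex sets (faces), closed under
  subsets. Faces with j elements are (j-1)-dimensional; the empty face gives the
  augmentation (reduced homology). Orientation is via the linear order on vertices:
  the boundary coefficient of sigma at sigma - {v} is (-1)^(number of vertices of
  sigma smaller than v).\<close>

definition bd_sign :: "'a::linorder set \<Rightarrow> 'a set \<Rightarrow> 'k::field" where
  "bd_sign \<sigma> \<tau> = (-1) ^ card {x\<in>\<sigma>. x < the_elem (\<sigma> - \<tau>)}"

definition is_chain :: "'a set set \<Rightarrow> nat \<Rightarrow> ('a set \<Rightarrow> 'k::field) \<Rightarrow> bool" where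
  "is_chain \<Delta> j c \<longleftrightarrow> (\<forall>\<sigma>. c \<sigma> \<noteq> 0 \<longrightarrow> \<sigma> \<in> \<Delta> \<and> card \<sigma> = j)"

definition boundary :: "'a::linorder set set \<Rightarrow> ('a set \<Rightarrow> 'k::field) \<Rightarrow> 'a set \<Rightarrow> 'k" where
  "boundary \<Delta> c \<tau> = (\<Sum>\<sigma>\<in>{\<sigma>\<in>\<Delta>. \<tau> \<subset> \<sigma> \<and> card \<sigma> = card \<tau> + 1}. bd_sign \<sigma> \<tau> * c \<sigma>)"

definition is_cycle :: "'a::linorder set set \<Rightarrow> nat \<Rightarrow> ('a set \<Rightarrow> 'k::field) \<Rightarrow> bool" where
  "is_cycle \<Delta> j c \<longleftrightarrow> is_chain \<Delta> j c \<and>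
     (\<forall>\<tau>\<in>\<Delta>. card \<tau> + 1 = j \<longrightarrow> boundary \<Delta> c \<tau> = 0)"

definition is_boundary :: "'a::linorder set set \<Rightarrow> nat \<Rightarrow> ('a set \<Rightarrow> 'k::field) \<Rightarrow> bool" where
  "is_boundary \<Delta> j c \<longleftrightarrow>
     (\<exists>w. is_chain \<Delta> (j + 1) w \<and> (\<forall>\<sigma>\<in>\<Delta>. card \<sigma> = j \<longrightarrow> c \<sigma> = boundary \<Delta> w \<sigma>))"

text \<open>reduced_homology_nonzero TYPE('k) Delta j  means  H~_{j-1}(Delta; k) \<noteq> 0:
  there is a (j-1)-cycle that is not a (j-1)-boundary.\<close>
definition reduced_homology_nonzero :: "'k::field itself \<Rightarrow> 'a::linorder set set \<Rightarrow> nat \<Rightarrow> bool" where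
  "reduced_homology_nonzero _ \<Delta> j \<longleftrightarrow>
     (\<exists>c :: 'a set \<Rightarrow> 'k. is_cycle \<Delta> j c \<and> \<not> is_boundary \<Delta> j c)"

definition ind_complex :: "'a set set \<Rightarrow> 'a set \<Rightarrow> 'a set set" where
  "ind_complex E S = {A. A \<subseteq> S \<and> (\<forall>e\<in>E. \<not> e \<subseteq> A)}"

definition reg :: "'k::field itself \<Rightarrow> 'a::linorder set \<Rightarrow> 'a set set \<Rightarrow> nat" where
  "reg k V E = Max {j. \<exists>S\<subseteq>V. reduced_homology_nonzero k (ind_complex E S) j}"

definition iso_C5 :: "'a set \<Rightarrow> 'a set set \<Rightarrow> bool" where
  "iso_C5 V E \<longleftrightarrow> (\<exists>f. bij_betw f V {0..<5::nat} \<and>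
     (\<forall>u\<in>V. \<forall>v\<in>V. {u, v} \<in> E \<longleftrightarrow> (f v = (f u + 1) mod 5 \<or> f u = (f v + 1) mod 5)))"

end

theory Submission
  imports Defs
begin

text \<open>
  Suppose that the independence complex of the graph induced on \<open>S\<close> has homology in degree
  \<open>j - 1\<close> and that no matching of \<open>S\<close> has more than \<open>j\<close> edges. By induction on \<open>S\<close>, there is an
  induced matching with \<open>j\<close> edges, or some connected component is a 5-cycle. If the homology
  persists after the deletion of a vertex, the induction hypothesis applies, since a vertex
  adjacent to a 5-cycle component would give a larger matching. Otherwise, by Mayer--Vietoris,
  the homology of \<open>S - N[v]\<close> is nonzero one degree lower for every \<open>v\<close>, so that \<open>S - N[v]\<close> has a
  5-cycle component or an induced matching with \<open>j - 1\<close> edges. If both alternatives fail for \<open>S\<close>,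
  then no edge \<open>v w\<close> has \<open>N[v] \<subseteq> N[w]\<close>, so all degrees are at least two; forbidding matchings of
  size \<open>j + 1\<close> then yields in turn that \<open>S\<close> is triangle-free, that \<open>N[v]\<close> and the induced matching
  of \<open>S - N[v]\<close> cover \<open>S\<close>, and that all degrees are two, whence \<open>S\<close> contains a 5-cycle
  component after all.
\<close>

section \<open>Signs, boundary operators and reduced homology\<close>

text \<open>For \<open>x\<close> outside \<open>\<tau>\<close>, this is the incidence sign of
  \<open>\<tau>\<close> in \<open>insert x \<tau>\<close>. It can be counted in
  \<open>\<tau>\<close> because \<open>x\<close> is not smaller than itself.\<close>

definition coface_sign :: "'a::linorder set \<Rightarrow> 'a \<Rightarrow> 'k::field" where
  "coface_sign \<tau> x = (-1) ^ card {y\<in>\<tau>. y < x}"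

text \<open>The boundary operator of the full simplex on \<open>S\<close>. It does not mention a
  complex, so chains of a deletion, a link and the whole complex can be compared directly.\<close>

definition bdry :: "'a::linorder set \<Rightarrow> ('a set \<Rightarrow> 'k::field) \<Rightarrow> 'a set \<Rightarrow> 'k" where
  "bdry S c \<tau> = (\<Sum>x\<in>S - \<tau>. coface_sign \<tau> x * c (insert x \<tau>))"

lemma coface_sign_square [simp]: "coface_sign \<tau> x * coface_sign \<tau> x = (1::'k::field)"
  by (simp add: coface_sign_def flip: power_add mult_2)

lemma coface_sign_square_left [simp]:
  "coface_sign \<tau> x * (coface_sign \<tau> x * a) = (a::'k::field)"
  by (simp flip: mult.assoc)

lemma coface_sign_insert:
  assumes "finite \<tau>" "x \<notin> \<tau>"
  shows "(coface_sign (insert x \<tau>) y :: 'k::field) = (if x < y then - 1 else 1) * coface_sign \<tau> y"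
proof -
  have "{z\<in>insert x \<tau>. z < y} = (if x < y then insert x {z\<in>\<tau>. z < y} else {z\<in>\<tau>. z < y})"
    by auto
  then show ?thesis
    using assms by (simp add: coface_sign_def)
qed

text \<open>Inserting the smaller of the two vertices changes the sign of the larger one, but not
  conversely, so exactly one of the two products is flipped.\<close>

lemma coface_sign_swap:
  assumes "finite \<tau>" "x \<notin> \<tau>" "y \<notin> \<tau>" "x \<noteq> y"
  shows "(coface_sign \<tau> x * coface_sign (insert x \<tau>) y :: 'k::field)
       = - (coface_sign \<tau> y * coface_sign (insert y \<tau>) x)"
  using assms by (cases x y rule: linorder_cases) (auto simp: coface_sign_insert)

text \<open>A coface with one more element is \<open>\<tau>\<close> plus a unique vertex, and
  \<open>c\<close> vanishes at the cofaces outside \<open>\<Delta>\<close>.\<close>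

lemma boundary_eq_bdry:
  fixes c :: "'a::linorder set \<Rightarrow> 'k::field"
  assumes "finite S" "\<Delta> \<subseteq> Pow S" "is_chain \<Delta> j c" "\<tau> \<subseteq> S"
  shows "boundary \<Delta> c \<tau> = bdry S c \<tau>"
proof -
  let ?X = "{x\<in>S - \<tau>. insert x \<tau> \<in> \<Delta>}"
  have fin: "finite \<tau>" using assms finite_subset by blast
  have "{\<sigma>\<in>\<Delta>. \<tau> \<subset> \<sigma> \<and> card \<sigma> = card \<tau> + 1} = (\<lambda>x. insert x \<tau>) ` ?X" (is "?L = ?R")
  proof
    show "?L \<subseteq> ?R"
    proof
      fix \<sigma> assume "\<sigma> \<in> ?L"
      then have \<sigma>: "\<sigma> \<in> \<Delta>" "\<tau> \<subseteq> \<sigma>" "card \<sigma> = card \<tau> + 1" by auto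
      then have "card (\<sigma> - \<tau>) = 1" using fin by (simp add: card_Diff_subset)
      then obtain x where "\<sigma> - \<tau> = {x}" by (auto simp: card_1_singleton_iff)
      then have "\<sigma> = insert x \<tau>" "x \<notin> \<tau>" using \<sigma> by auto
      then show "\<sigma> \<in> ?R" using \<sigma> assms(2) by auto
    qed
    show "?R \<subseteq> ?L" using fin by auto
  qed
  moreover have "inj_on (\<lambda>x. insert x \<tau>) ?X"
    by (auto simp: inj_on_def)
  ultimately have "boundary \<Delta> c \<tau> = (\<Sum>x\<in>?X. bd_sign (insert x \<tau>) \<tau> * c (insert x \<tau>))"
    by (simp add: boundary_def sum.reindex)
  also have "\<dots> = (\<Sum>x\<in>?X. coface_sign \<tau> x * c (insert x \<tau>))"
  proof (rule sum.cong)
    fix x assume x: "x \<in> ?X"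
    then have "insert x \<tau> - \<tau> = {x}" "{y \<in> insert x \<tau>. y < x} = {y \<in> \<tau>. y < x}" by auto
    then show "bd_sign (insert x \<tau>) \<tau> * c (insert x \<tau>) = coface_sign \<tau> x * c (insert x \<tau>)"
      by (simp add: bd_sign_def coface_sign_def)
  qed simp
  also have "\<dots> = bdry S c \<tau>"
    unfolding bdry_def using assms
    by (intro sum.mono_neutral_left) (auto simp: is_chain_def)
  finally show ?thesis .
qed

text \<open>Cofaces that leave \<open>T\<close> lie outside the support of \<open>c\<close>. If
  \<open>\<tau>\<close> already leaves \<open>T\<close>, then so do all its cofaces.\<close>

lemma bdry_subset:
  assumes "finite S" "T \<subseteq> S" "\<And>\<sigma>. c \<sigma> \<noteq> 0 \<Longrightarrow> \<sigma> \<subseteq> T"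
  shows "bdry S c \<tau> = (if \<tau> \<subseteq> T then bdry T c \<tau> else 0)"
proof (cases "\<tau> \<subseteq> T")
  case True
  have "bdry T c \<tau> = bdry S c \<tau>"
    unfolding bdry_def using assms by (intro sum.mono_neutral_left) auto
  with True show ?thesis by simp
next
  case False
  then have "c (insert x \<tau>) = 0" for x using assms(3) by blast
  with False show ?thesis by (simp add: bdry_def)
qed

lemma bdry_cong:
  assumes "\<And>\<sigma>. \<sigma> \<subseteq> S \<Longrightarrow> c \<sigma> = d \<sigma>" "\<tau> \<subseteq> S"
  shows "bdry S c \<tau> = bdry S d \<tau>"
  unfolding bdry_def using assms by (intro sum.cong) auto

lemma bdry_add: "bdry S (\<lambda>\<sigma>. c \<sigma> + d \<sigma>) \<tau> = bdry S c \<tau> + bdry S d \<tau>"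
  by (simp add: bdry_def distrib_left sum.distrib)

lemma bdry_diff: "bdry S (\<lambda>\<sigma>. c \<sigma> - d \<sigma>) \<tau> = bdry S c \<tau> - bdry S d \<tau>"
  by (simp add: bdry_def right_diff_distrib sum_subtractf)

lemma bdry_bdry:
  fixes c :: "'a::linorder set \<Rightarrow> 'k::field"
  assumes "finite S" "\<tau> \<subseteq> S"
  shows "bdry S (bdry S c) \<tau> = 0"
proof -
  define f where "f = (\<lambda>(x, y). coface_sign \<tau> x * coface_sign (insert x \<tau>) y * c (insert y (insert x \<tau>)))"
  let ?R = "S - \<tau>"
  let ?A = "{(x, y). x \<in> ?R \<and> y \<in> ?R \<and> x < y}"
  let ?B = "{(x, y). x \<in> ?R \<and> y \<in> ?R \<and> y < x}"
  have fin: "finite \<tau>" using assms finite_subset by blast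
  have sub: "?A \<subseteq> ?R \<times> ?R" "?B \<subseteq> ?R \<times> ?R" by auto
  have finAB: "finite ?A" "finite ?B"
    by (rule finite_subset[OF sub(1)], simp add: assms) (rule finite_subset[OF sub(2)], simp add: assms)
  have "bdry S (bdry S c) \<tau> = (\<Sum>x\<in>?R. \<Sum>y\<in>S - insert x \<tau>. f (x, y))"
    by (simp add: bdry_def f_def sum_distrib_left mult.assoc)
  also have "\<dots> = (\<Sum>p\<in>(SIGMA x:?R. S - insert x \<tau>). f p)"
    using assms by (subst sum.Sigma) auto
  also have "(SIGMA x:?R. S - insert x \<tau>) = ?A \<union> ?B" by auto
  also have "sum f (?A \<union> ?B) = sum f ?A + sum f ?B"
    using finAB by (intro sum.union_disjoint) auto
  \<comment> \<open>Adding the same two vertices in the opposite order gives the opposite sign, so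
    the two halves cancel.\<close>
  also have "sum f ?B = (\<Sum>p\<in>?A. - f p)"
  proof (rule sum.reindex_bij_witness[of _ "\<lambda>(x, y). (y, x)" "\<lambda>(x, y). (y, x)"])
    fix p assume "p \<in> ?B"
    then obtain x y where p: "p = (x, y)" "x \<notin> \<tau>" "y \<notin> \<tau>" "x \<noteq> y" by auto
    have "insert y (insert x \<tau>) = insert x (insert y \<tau>)" by auto
    then show "- f (case p of (x, y) \<Rightarrow> (y, x)) = f p"
      using p coface_sign_swap[OF fin, of x y, where ?'k = 'k] by (simp add: f_def)
  qed auto
  finally show ?thesis by (simp add: sum_negf)
qed

text \<open>The cone with apex \<open>v\<close> over \<open>u\<close>, signed so that its boundary
  is exactly \<open>u\<close> on the faces that avoid \<open>v\<close>.\<close>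

definition cone_chain :: "'a::linorder \<Rightarrow> ('a set \<Rightarrow> 'k::field) \<Rightarrow> 'a set \<Rightarrow> 'k" where
  "cone_chain v u \<sigma> = (if v \<in> \<sigma> then coface_sign (\<sigma> - {v}) v * u (\<sigma> - {v}) else 0)"

lemma cone_chain_insert [simp]:
  "v \<notin> \<tau> \<Longrightarrow> cone_chain v u (insert v \<tau>) = coface_sign \<tau> v * u \<tau>"
  by (simp add: cone_chain_def)

lemma bdry_cone_chain_base:
  assumes "finite S" "v \<in> S" "v \<notin> \<tau>"
  shows "bdry S (cone_chain v u) \<tau> = u \<tau>"
proof -
  have "bdry S (cone_chain v u) \<tau> = (\<Sum>x\<in>{v}. coface_sign \<tau> x * cone_chain v u (insert x \<tau>))"
    unfolding bdry_def using assms
    by (intro sum.mono_neutral_right) (auto simp: cone_chain_def)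
  then show ?thesis using assms by simp
qed

text \<open>On faces through the apex, the boundary of a cone is minus the cone over the
  boundary.\<close>

lemma bdry_cone_chain_insert:
  assumes "finite S" "\<tau> \<subseteq> S" "v \<notin> \<tau>"
  shows "bdry S (cone_chain v u) (insert v \<tau>) = - (coface_sign \<tau> v * bdry (S - {v}) u \<tau>)"
proof -
  have fin: "finite \<tau>" using assms finite_subset by blast
  have "coface_sign (insert v \<tau>) x * cone_chain v u (insert x (insert v \<tau>))
      = - (coface_sign \<tau> v * (coface_sign \<tau> x * u (insert x \<tau>)))" if "x \<in> S - insert v \<tau>" for x
  proof -
    have "insert x (insert v \<tau>) = insert v (insert x \<tau>)" "v \<notin> insert x \<tau>" using that assms by auto
    then show ?thesis
      using that assms fin by (cases x v rule: linorder_cases) (auto simp: coface_sign_insert)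
  qed
  moreover have "S - {v} - \<tau> = S - insert v \<tau>" by auto
  ultimately show ?thesis
    by (simp add: bdry_def sum_negf sum_distrib_left)
qed

text \<open>Because the chains are supported on independent sets of one size, the conditions of
  \<^const>\<open>is_cycle\<close> and \<^const>\<open>is_boundary\<close> may be imposed on all subsets of \<open>S\<close>.\<close>

lemma reduced_homology_ind_complex_iff:
  fixes S :: "'a::linorder set"
  assumes "finite S"
  shows "reduced_homology_nonzero TYPE('k::field) (ind_complex E S) j \<longleftrightarrow>
    (\<exists>c :: 'a set \<Rightarrow> 'k. is_chain (ind_complex E S) j c \<and> (\<forall>\<tau>\<subseteq>S. bdry S c \<tau> = 0) \<and>
       \<not> (\<exists>w. is_chain (ind_complex E S) (j + 1) w \<and> (\<forall>\<sigma>\<subseteq>S. c \<sigma> = bdry S w \<sigma>)))"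
proof -
  let ?\<Delta> = "ind_complex E S"
  have pow: "?\<Delta> \<subseteq> Pow S" by (auto simp: ind_complex_def)
  \<comment> \<open>Independence passes to subsets, so no coface of such a \<open>\<tau>\<close>
    lies in the support of the chain.\<close>
  have out: "bdry S c \<tau> = 0" if "is_chain ?\<Delta> i c" "\<tau> \<subseteq> S" "\<tau> \<notin> ?\<Delta> \<or> card \<tau> + 1 \<noteq> i"
    for c :: "'a set \<Rightarrow> 'k" and \<tau> i
  proof -
    have "c (insert x \<tau>) = 0" if "x \<in> S - \<tau>" for x
    proof (rule ccontr)
      assume "c (insert x \<tau>) \<noteq> 0"
      then have *: "insert x \<tau> \<in> ?\<Delta>" "card (insert x \<tau>) = i"
        using \<open>is_chain ?\<Delta> i c\<close> by (auto simp: is_chain_def)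
      have "\<tau> \<in> ?\<Delta>" using *(1) by (auto simp: ind_complex_def)
      moreover have "finite \<tau>" using \<open>\<tau> \<subseteq> S\<close> assms finite_subset by blast
      ultimately show False using * \<open>\<tau> \<notin> ?\<Delta> \<or> _\<close> \<open>x \<in> S - \<tau>\<close> by auto
    qed
    then show ?thesis by (simp add: bdry_def)
  qed
  have cyc: "is_cycle ?\<Delta> j c \<longleftrightarrow> is_chain ?\<Delta> j c \<and> (\<forall>\<tau>\<subseteq>S. bdry S c \<tau> = 0)"
    for c :: "'a set \<Rightarrow> 'k"
    unfolding is_cycle_def using boundary_eq_bdry[OF assms pow, of j c] out[of j c] pow
    by (metis Pow_iff subsetD)
  have bd: "is_boundary ?\<Delta> j c \<longleftrightarrow>
      (\<exists>w. is_chain ?\<Delta> (j + 1) w \<and> (\<forall>\<sigma>\<subseteq>S. c \<sigma> = bdry S w \<sigma>))"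
    if "is_chain ?\<Delta> j c" for c :: "'a set \<Rightarrow> 'k"
  proof -
    have "(\<forall>\<sigma>\<in>?\<Delta>. card \<sigma> = j \<longrightarrow> c \<sigma> = boundary ?\<Delta> w \<sigma>) \<longleftrightarrow> (\<forall>\<sigma>\<subseteq>S. c \<sigma> = bdry S w \<sigma>)"
      if w: "is_chain ?\<Delta> (j + 1) w" for w :: "'a set \<Rightarrow> 'k"
    proof -
      have "c \<sigma> = 0" if "\<sigma> \<notin> ?\<Delta> \<or> card \<sigma> \<noteq> j" for \<sigma>
        using \<open>is_chain ?\<Delta> j c\<close> that by (auto simp: is_chain_def)
      then show ?thesis
        using boundary_eq_bdry[OF assms pow w] out[OF w] pow
        by (metis Pow_iff subsetD add_right_cancel)
    qed
    then show ?thesis unfolding is_boundary_def by (intro iff_exI conj_cong) simp_all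
  qed
  show ?thesis
    unfolding reduced_homology_nonzero_def cyc using bd by (metis (no_types, lifting))
qed

section \<open>Deletion and link of a vertex in the independence complex\<close>

definition nbrs :: "'a set set \<Rightarrow> 'a set \<Rightarrow> 'a \<Rightarrow> 'a set" where
  "nbrs E S v = {u\<in>S. adj E v u}"

text \<open>This identifies the link of \<open>v\<close>: an edge inside
  \<open>insert v \<tau>\<close> lies in \<open>\<tau>\<close> or joins \<open>v\<close> to a
  neighbour in \<open>\<tau>\<close>.\<close>

lemma ind_complex_insert_iff:
  assumes E: "\<forall>e\<in>E. card e = 2" and "v \<in> S" "v \<notin> \<tau>"
  shows "insert v \<tau> \<in> ind_complex E S \<longleftrightarrow> \<tau> \<in> ind_complex E (S - insert v (nbrs E S v))"
proof
  assume "insert v \<tau> \<in> ind_complex E S"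
  then show "\<tau> \<in> ind_complex E (S - insert v (nbrs E S v))"
    using assms(2,3) by (auto simp: ind_complex_def nbrs_def adj_def)
next
  assume \<tau>: "\<tau> \<in> ind_complex E (S - insert v (nbrs E S v))"
  have "\<not> e \<subseteq> insert v \<tau>" if "e \<in> E" for e
  proof
    assume e: "e \<subseteq> insert v \<tau>"
    have "v \<in> e" using \<tau> e that by (auto simp: ind_complex_def)
    moreover have "card e = 2" using E \<open>e \<in> E\<close> by blast
    ultimately obtain u where "e = {v, u}" "u \<noteq> v" by (auto simp: card_2_iff doubleton_eq_iff)
    then show False using e \<tau> that by (auto simp: ind_complex_def nbrs_def adj_def)
  qed
  then show "insert v \<tau> \<in> ind_complex E S" using \<tau> assms(2) by (auto simp: ind_complex_def)
qed

lemma is_chain_cone_chain: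
  assumes E: "\<forall>e\<in>E. card e = 2" and "finite S" "v \<in> S"
    and u: "is_chain (ind_complex E (S - insert v (nbrs E S v))) j u"
  shows "is_chain (ind_complex E S) (Suc j) (cone_chain v u)"
  unfolding is_chain_def
proof (intro allI impI)
  fix \<sigma> assume "cone_chain v u \<sigma> \<noteq> 0"
  then have v: "v \<in> \<sigma>" and "u (\<sigma> - {v}) \<noteq> 0" by (auto simp: cone_chain_def split: if_splits)
  then have *: "\<sigma> - {v} \<in> ind_complex E (S - insert v (nbrs E S v))" "card (\<sigma> - {v}) = j"
    using u by (auto simp: is_chain_def)
  then have "\<sigma> - {v} \<subseteq> S" by (auto simp: ind_complex_def)
  then have "finite (\<sigma> - {v})" using assms(2) finite_subset by blast
  then have "card \<sigma> = Suc j" using * v by (metis card_insert_disjoint insert_Diff Diff_iff singletonI)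
  moreover have "\<sigma> \<in> ind_complex E S"
    using ind_complex_insert_iff[OF E \<open>v \<in> S\<close>, of "\<sigma> - {v}"] * v by (simp add: insert_absorb)
  ultimately show "\<sigma> \<in> ind_complex E S \<and> card \<sigma> = Suc j" by simp
qed

text \<open>The complex is a cone with apex \<open>v\<close>, and a cycle \<open>c\<close> is the
  boundary of the cone over the part of \<open>c\<close> that avoids \<open>v\<close>.\<close>

lemma reduced_homology_isolated_vertex:
  fixes S :: "'a::linorder set"
  assumes E: "\<forall>e\<in>E. card e = 2" and fin: "finite S" and v: "v \<in> S" "nbrs E S v = {}"
  shows "\<not> reduced_homology_nonzero TYPE('k::field) (ind_complex E S) j"
proof -
  have "\<exists>w. is_chain (ind_complex E S) (j + 1) w \<and> (\<forall>\<sigma>\<subseteq>S. c \<sigma> = bdry S w \<sigma>)"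
    if c: "is_chain (ind_complex E S) j c" "\<forall>\<tau>\<subseteq>S. bdry S c \<tau> = 0" for c :: "'a set \<Rightarrow> 'k"
  proof -
    define d where "d \<sigma> = (if v \<in> \<sigma> then 0 else c \<sigma>)" for \<sigma>
    have d: "is_chain (ind_complex E (S - {v})) j d"
      using c(1) by (auto simp: is_chain_def d_def ind_complex_def split: if_splits)
    then have W: "is_chain (ind_complex E S) (j + 1) (cone_chain v d)"
      using is_chain_cone_chain[OF E fin v(1), of j d] v(2) by simp
    have "c \<sigma> = bdry S (cone_chain v d) \<sigma>" if \<sigma>: "\<sigma> \<subseteq> S" for \<sigma>
    proof (cases "v \<in> \<sigma>")
      case False
      then show ?thesis using bdry_cone_chain_base[OF fin v(1) False, of d] by (simp add: d_def)
    next
      case True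
      define \<tau> where "\<tau> = \<sigma> - {v}"
      have \<tau>: "\<sigma> = insert v \<tau>" "v \<notin> \<tau>" "\<tau> \<subseteq> S" using True \<sigma> by (auto simp: \<tau>_def)
      \<comment> \<open>The cycle condition at \<open>\<tau>\<close>, with the summand for
        \<open>v\<close> split off, expresses \<open>c (insert v \<tau>)\<close> through the
        boundary of \<open>d\<close>.\<close>
      have "0 = bdry S c \<tau>" using c(2) \<tau> by simp
      also have "\<dots> = coface_sign \<tau> v * c (insert v \<tau>)
          + (\<Sum>x\<in>S - \<tau> - {v}. coface_sign \<tau> x * c (insert x \<tau>))"
        unfolding bdry_def using fin v \<tau> by (intro sum.remove) auto
      also have "(\<Sum>x\<in>S - \<tau> - {v}. coface_sign \<tau> x * c (insert x \<tau>)) = bdry (S - {v}) d \<tau>"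
        unfolding bdry_def using \<tau> by (intro sum.cong) (auto simp: d_def)
      finally have "bdry (S - {v}) d \<tau> = - (coface_sign \<tau> v * c (insert v \<tau>))"
        by (simp add: eq_neg_iff_add_eq_0 add.commute)
      then show ?thesis
        using bdry_cone_chain_insert[OF fin \<tau>(3) \<tau>(2), of d] \<tau>(1) by simp
    qed
    with W show ?thesis by blast
  qed
  then show ?thesis unfolding reduced_homology_ind_complex_iff[OF fin] by blast
qed

text \<open>The exactness of the Mayer--Vietoris sequence for the decomposition of the complex into
  the deletion of \<open>v\<close> and the cone over the link of \<open>v\<close>.\<close>

lemma reduced_homology_deletion_or_link:
  fixes S :: "'a::linorder set"
  assumes E: "\<forall>e\<in>E. card e = 2" and fin: "finite S" and v: "v \<in> S"
    and nz: "reduced_homology_nonzero TYPE('k::field) (ind_complex E S) (Suc i)"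
  shows "reduced_homology_nonzero TYPE('k) (ind_complex E (S - {v})) (Suc i) \<or>
    reduced_homology_nonzero TYPE('k) (ind_complex E (S - insert v (nbrs E S v))) i"
proof (rule ccontr)
  let ?L = "S - insert v (nbrs E S v)"
  assume neg: "\<not> ?thesis"
  have finL: "finite ?L" and finD: "finite (S - {v})" using fin by auto
  obtain c :: "'a set \<Rightarrow> 'k" where c: "is_chain (ind_complex E S) (Suc i) c"
      "\<And>\<tau>. \<tau> \<subseteq> S \<Longrightarrow> bdry S c \<tau> = 0"
    and nb: "\<And>w. is_chain (ind_complex E S) (i + 2) w \<Longrightarrow> \<exists>\<sigma>\<subseteq>S. c \<sigma> \<noteq> bdry S w \<sigma>"
    using nz unfolding reduced_homology_ind_complex_iff[OF fin] by auto
  \<comment> \<open>The link part of \<open>c\<close>: on faces containing \<open>v\<close>,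
    \<open>c\<close> agrees with the cone over \<open>l\<close>. On classes this is the connecting
    map, up to sign.\<close>
  define l where "l \<tau> = (if v \<in> \<tau> then 0 else coface_sign \<tau> v * c (insert v \<tau>))" for \<tau>
  have l: "is_chain (ind_complex E ?L) i l"
    unfolding is_chain_def
  proof (intro allI impI)
    fix \<tau> assume "l \<tau> \<noteq> 0"
    then have "v \<notin> \<tau>" "c (insert v \<tau>) \<noteq> 0" by (auto simp: l_def split: if_splits)
    then have *: "insert v \<tau> \<in> ind_complex E S" "card (insert v \<tau>) = Suc i"
      using c(1) by (auto simp: is_chain_def)
    then have "finite (insert v \<tau>)" by (metis card.infinite nat.distinct(1))
    then show "\<tau> \<in> ind_complex E ?L \<and> card \<tau> = i"
      using * ind_complex_insert_iff[OF E v \<open>v \<notin> \<tau>\<close>] \<open>v \<notin> \<tau>\<close> by auto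
  qed
  have subL: "\<sigma> \<subseteq> ?L" if "is_chain (ind_complex E ?L) k u" "u \<sigma> \<noteq> 0"
    for u :: "'a set \<Rightarrow> 'k" and \<sigma> k
    using that unfolding is_chain_def ind_complex_def by blast
  have bdL: "bdry (S - {v}) u \<tau> = (if \<tau> \<subseteq> ?L then bdry ?L u \<tau> else 0)"
    if "is_chain (ind_complex E ?L) k u" for u :: "'a set \<Rightarrow> 'k" and \<tau> k
    using subL[OF that] by (intro bdry_subset[OF finD]) auto
  \<comment> \<open>That \<open>l\<close> is a cycle is the cycle condition of \<open>c\<close> at
    the faces containing \<open>v\<close>.\<close>
  have "bdry ?L l \<tau> = 0" if "\<tau> \<subseteq> ?L" for \<tau>
  proof -
    have \<tau>: "v \<notin> \<tau>" "\<tau> \<subseteq> S" using that by auto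
    have "0 = bdry S c (insert v \<tau>)" using c(2) \<tau> v by simp
    also have "\<dots> = bdry S (cone_chain v l) (insert v \<tau>)"
      unfolding bdry_def
    proof (intro sum.cong)
      fix x assume "x \<in> S - insert v \<tau>"
      then have "v \<notin> insert x \<tau>" "insert x (insert v \<tau>) = insert v (insert x \<tau>)" using \<tau> by auto
      then show "coface_sign (insert v \<tau>) x * c (insert x (insert v \<tau>)) =
          coface_sign (insert v \<tau>) x * cone_chain v l (insert x (insert v \<tau>))"
        by (simp add: l_def)
    qed simp
    also have "\<dots> = - (coface_sign \<tau> v * bdry ?L l \<tau>)"
      using bdry_cone_chain_insert[OF fin \<tau>(2,1), of l] bdL[OF l, of \<tau>] that by simp
    finally show ?thesis by (simp add: coface_sign_def)
  qed
  then obtain w where w: "is_chain (ind_complex E ?L) (Suc i) w"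
      "\<And>\<sigma>. \<sigma> \<subseteq> ?L \<Longrightarrow> l \<sigma> = bdry ?L w \<sigma>"
    using neg l unfolding reduced_homology_ind_complex_iff[OF finL] by auto
  let ?W = "cone_chain v w"
  have W: "is_chain (ind_complex E S) (i + 2) ?W"
    using is_chain_cone_chain[OF E fin v w(1)] by simp
  have lw: "l \<tau> = bdry (S - {v}) w \<tau>" for \<tau>
    using bdL[OF w(1), of \<tau>] w(2)[of \<tau>] subL[OF l, of \<tau>] by auto
  \<comment> \<open>With \<open>w\<close> bounding \<open>l\<close> in the link, adding the boundary
    of the cone over \<open>w\<close> to \<open>c\<close> cancels all coefficients on faces
    containing \<open>v\<close>. Thus \<open>d\<close> is a cycle homologous to \<open>c\<close>
    that lives in the deletion.\<close>
  define d where "d \<sigma> = (if v \<in> \<sigma> then 0 else c \<sigma> + w \<sigma>)" for \<sigma>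
  have d: "is_chain (ind_complex E (S - {v})) (Suc i) d"
    unfolding is_chain_def
  proof (intro allI impI)
    fix \<sigma> assume "d \<sigma> \<noteq> 0"
    then have "v \<notin> \<sigma>" "c \<sigma> \<noteq> 0 \<or> w \<sigma> \<noteq> 0" by (auto simp: d_def split: if_splits)
    then show "\<sigma> \<in> ind_complex E (S - {v}) \<and> card \<sigma> = Suc i"
      using c(1) w(1) by (auto simp: is_chain_def ind_complex_def)
  qed
  have dW: "d \<sigma> = c \<sigma> + bdry S ?W \<sigma>" if \<sigma>: "\<sigma> \<subseteq> S" for \<sigma>
  proof (cases "v \<in> \<sigma>")
    case False
    then show ?thesis using bdry_cone_chain_base[OF fin v False, of w] by (simp add: d_def)
  next
    case True
    define \<tau> where "\<tau> = \<sigma> - {v}"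
    have \<tau>: "\<sigma> = insert v \<tau>" "v \<notin> \<tau>" "\<tau> \<subseteq> S" using True \<sigma> by (auto simp: \<tau>_def)
    then show ?thesis
      using bdry_cone_chain_insert[OF fin \<tau>(3,2), of w] by (simp add: d_def l_def flip: lw)
  qed
  have bdD: "bdry S u \<tau> = (if \<tau> \<subseteq> S - {v} then bdry (S - {v}) u \<tau> else 0)"
    if "is_chain (ind_complex E (S - {v})) k u" for u :: "'a set \<Rightarrow> 'k" and \<tau> k
  proof (intro bdry_subset[OF fin])
    show "\<sigma> \<subseteq> S - {v}" if "u \<sigma> \<noteq> 0" for \<sigma>
      using that \<open>is_chain (ind_complex E (S - {v})) k u\<close>
      unfolding is_chain_def ind_complex_def by blast
  qed auto
  have "bdry (S - {v}) d \<tau> = 0" if "\<tau> \<subseteq> S - {v}" for \<tau>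
  proof -
    have \<tau>: "\<tau> \<subseteq> S" using that by auto
    have "bdry (S - {v}) d \<tau> = bdry S d \<tau>" using bdD[OF d] that by simp
    also have "\<dots> = bdry S (\<lambda>\<sigma>. c \<sigma> + bdry S ?W \<sigma>) \<tau>" using dW \<tau> by (rule bdry_cong)
    also have "\<dots> = 0" using c(2)[OF \<tau>] bdry_bdry[OF fin \<tau>, of ?W] by (simp add: bdry_add)
    finally show ?thesis .
  qed
  then obtain z where z: "is_chain (ind_complex E (S - {v})) (i + 2) z"
      "\<And>\<sigma>. \<sigma> \<subseteq> S - {v} \<Longrightarrow> d \<sigma> = bdry (S - {v}) z \<sigma>"
    using neg d unfolding reduced_homology_ind_complex_iff[OF finD] by auto
  have dz: "d \<sigma> = bdry S z \<sigma>" if "\<sigma> \<subseteq> S" for \<sigma>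
    using that z(2)[of \<sigma>] bdD[OF z(1), of \<sigma>] by (auto simp: d_def)
  \<comment> \<open>If \<open>z\<close> bounds \<open>d\<close>, then subtracting the cone over
    \<open>w\<close> yields a chain bounding \<open>c\<close>, contrary to its choice.\<close>
  have "is_chain (ind_complex E S) (i + 2) (\<lambda>\<sigma>. z \<sigma> - ?W \<sigma>)"
    unfolding is_chain_def
  proof (intro allI impI)
    fix \<sigma> assume "z \<sigma> - ?W \<sigma> \<noteq> 0"
    then have "z \<sigma> \<noteq> 0 \<or> ?W \<sigma> \<noteq> 0" by auto
    then show "\<sigma> \<in> ind_complex E S \<and> card \<sigma> = i + 2"
      using z(1) W by (auto simp: is_chain_def ind_complex_def)
  qed
  then obtain \<sigma> where "\<sigma> \<subseteq> S" "c \<sigma> \<noteq> bdry S (\<lambda>\<sigma>. z \<sigma> - ?W \<sigma>) \<sigma>" using nb by blast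
  then show False using dz[of \<sigma>] dW[of \<sigma>] by (simp add: bdry_diff eq_diff_eq)
qed

section \<open>Matchings and induced matchings inside a vertex set\<close>

lemma nbrs_iff: "u \<in> nbrs E S v \<longleftrightarrow> u \<in> S \<and> adj E v u"
  by (simp add: nbrs_def)

lemma adj_sym: "adj E u v \<longleftrightarrow> adj E v u"
  by (simp add: adj_def insert_commute)

lemma adj_irrefl:
  assumes "\<forall>e\<in>E. card e = 2" shows "\<not> adj E u u"
  using assms by (force simp: adj_def)

text \<open>Since infinite sets have \<open>card\<close> 0, finiteness is demanded
  separately.\<close>

definition has_matching :: "'a set set \<Rightarrow> 'a set \<Rightarrow> nat \<Rightarrow> bool" where
  "has_matching E S k \<longleftrightarrow> (\<exists>M. is_matching E M \<and> \<Union>M \<subseteq> S \<and> finite M \<and> card M = k)"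

text \<open>Testing inducedness against all of \<open>E\<close> agrees with testing it in the
  subgraph on \<open>S\<close>, because only edges inside \<open>\<Union>M\<close> matter.\<close>

definition has_induced_matching :: "'a set set \<Rightarrow> 'a set \<Rightarrow> nat \<Rightarrow> bool" where
  "has_induced_matching E S k \<longleftrightarrow> (\<exists>M. is_induced_matching E M \<and> \<Union>M \<subseteq> S \<and> finite M \<and> card M = k)"

lemma has_matching_0: "has_matching E S 0"
  by (auto simp: has_matching_def is_matching_def intro!: exI[of _ "{}"])

lemma has_matching_empty:
  assumes "\<forall>e\<in>E. card e = 2" "has_matching E {} k"
  shows "k = 0"
proof -
  obtain M where M: "is_matching E M" "\<Union>M \<subseteq> {}" "card M = k"
    using assms(2) by (auto simp: has_matching_def)
  have "e \<noteq> {}" if "e \<in> M" for e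
    using assms(1) M(1) that by (force simp: is_matching_def)
  then have "M = {}" using M(2) by blast
  then show ?thesis using M(3) by simp
qed

lemma has_matching_mono:
  assumes "has_matching E S k" "S \<subseteq> T" "l \<le> k"
  shows "has_matching E T l"
proof -
  obtain M where M: "is_matching E M" "\<Union>M \<subseteq> S" "finite M" "card M = k"
    using assms by (auto simp: has_matching_def)
  then obtain M' where M': "M' \<subseteq> M" "card M' = l" "finite M'"
    using assms(3) by (metis obtain_subset_with_card_n)
  have "is_matching E M'" using M(1) M'(1) unfolding is_matching_def by blast
  moreover have "\<Union>M' \<subseteq> T" using M(2) M'(1) assms(2) by blast
  ultimately show ?thesis using M' unfolding has_matching_def by blast
qed

lemma has_matching_add_edge:
  assumes "adj E a b" "has_matching E S k" "insert a (insert b S) \<subseteq> T" "a \<notin> S" "b \<notin> S"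
  shows "has_matching E T (Suc k)"
proof -
  obtain M where M: "is_matching E M" "\<Union>M \<subseteq> S" "finite M" "card M = k"
    using assms by (auto simp: has_matching_def)
  have "{a, b} \<notin> M" using M(2) assms by auto
  moreover have "is_matching E (insert {a, b} M)"
    using M(1,2) assms unfolding is_matching_def adj_def by blast
  moreover have "\<Union>(insert {a, b} M) \<subseteq> T" using M(2) assms by auto
  ultimately show ?thesis
    using M(3,4) unfolding has_matching_def by (intro exI[of _ "insert {a, b} M"]) auto
qed

lemma has_induced_matching_mono:
  "has_induced_matching E S k \<Longrightarrow> S \<subseteq> T \<Longrightarrow> has_induced_matching E T k"
  unfolding has_induced_matching_def by blast

text \<open>No edge joins \<open>v\<close> or \<open>w\<close> to a vertex outside both closed
  neighbourhoods.\<close>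

lemma has_induced_matching_add_edge:
  assumes E: "\<forall>e\<in>E. card e = 2" and "adj E v w" "v \<in> S" "w \<in> S"
    and ind: "has_induced_matching E (S - (insert v (nbrs E S v) \<union> insert w (nbrs E S w))) k"
  shows "has_induced_matching E S (Suc k)"
proof -
  obtain M where M: "is_induced_matching E M" "finite M" "card M = k"
    "\<Union>M \<subseteq> S - (insert v (nbrs E S v) \<union> insert w (nbrs E S w))"
    using ind by (auto simp: has_induced_matching_def)
  let ?M = "insert {v, w} M"
  have disj: "v \<notin> \<Union>M" "w \<notin> \<Union>M" using M(4) by auto
  have "is_matching E ?M"
    using M(1) disj assms(2) unfolding is_induced_matching_def is_matching_def adj_def by blast
  moreover have "e \<in> ?M" if e: "e \<in> E" "e \<subseteq> \<Union>?M" for e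
  proof -
    obtain p q where pq: "e = {p, q}" "p \<noteq> q" using E e(1) by (meson card_2_iff)
    have adj: "adj E p q" "adj E q p" using e(1) pq by (simp_all add: adj_def insert_commute)
    have *: "p \<in> insert v (insert w (\<Union>M))" "q \<in> insert v (insert w (\<Union>M))"
      using e(2) pq(1) by auto
    have cross: "\<not> adj E x z" if "x \<in> {v, w}" "z \<in> \<Union>M" for x z
      using that M(4) by (auto simp: nbrs_iff)
    show ?thesis
    proof (cases "p \<in> {v, w} \<or> q \<in> {v, w}")
      case True
      then have "p \<in> {v, w}" "q \<in> {v, w}" using * adj cross by blast+
      then show ?thesis using pq by auto
    next
      case False
      then have "e \<subseteq> \<Union>M" using * pq(1) by auto
      then show ?thesis using M(1) e(1) by (auto simp: is_induced_matching_def)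
    qed
  qed
  ultimately have "is_induced_matching E ?M" by (simp add: is_induced_matching_def)
  moreover have "\<Union>?M \<subseteq> S" using M(4) assms(3,4) by auto
  moreover have "{v, w} \<notin> M" using disj by auto
  ultimately show ?thesis
    using M(2,3) unfolding has_induced_matching_def by (intro exI[of _ ?M]) auto
qed

text \<open>This gives the bound of the regularity by the matching number. Passing to the link of
  \<open>v\<close> costs one degree, and an edge at \<open>v\<close> makes up for it.\<close>

lemma reduced_homology_imp_matching:
  fixes S :: "'a::linorder set"
  assumes E: "\<forall>e\<in>E. card e = 2"
  shows "finite S \<Longrightarrow> reduced_homology_nonzero TYPE('k::field) (ind_complex E S) j \<Longrightarrow> has_matching E S j"
proof (induction "card S" arbitrary: S j rule: less_induct)
  case less
  show ?case
  proof (cases j)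
    case 0
    then show ?thesis by (simp add: has_matching_0)
  next
    case (Suc i)
    \<comment> \<open>Over the empty vertex set the only possible face is empty, so chains on faces
      of size \<open>Suc i\<close> vanish.\<close>
    have "S \<noteq> {}"
    proof
      assume S: "S = {}"
      obtain c :: "'a set \<Rightarrow> 'k" where c: "is_chain (ind_complex E S) (Suc i) c"
        "\<And>w. is_chain (ind_complex E S) (Suc i + 1) w \<Longrightarrow> \<exists>\<sigma>\<subseteq>S. c \<sigma> \<noteq> bdry S w \<sigma>"
        using less.prems(2) unfolding reduced_homology_ind_complex_iff[OF less.prems(1)] Suc
        by (elim exE conjE) (rule that, assumption, metis)
      have "is_chain (ind_complex E S) (Suc i + 1) (\<lambda>_. 0 :: 'k)" by (simp add: is_chain_def)
      from c(2)[OF this] have "c {} \<noteq> 0" using S by (simp add: bdry_def)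
      then show False using c(1) by (auto simp: is_chain_def)
    qed
    then obtain v where v: "v \<in> S" by blast
    obtain w where w: "w \<in> nbrs E S v"
      using reduced_homology_isolated_vertex[OF E less.prems(1) v] less.prems(2) by blast
    have lt: "card (S - insert v A) < card S" for A
      using less.prems(1) v by (intro psubset_card_mono) auto
    from reduced_homology_deletion_or_link[OF E less.prems(1) v less.prems(2)[unfolded Suc]]
    show ?thesis
    proof
      assume "reduced_homology_nonzero TYPE('k) (ind_complex E (S - {v})) (Suc i)"
      then have "has_matching E (S - {v}) (Suc i)" using less.hyps[OF lt] less.prems(1) by blast
      then show ?thesis using Suc has_matching_mono by blast
    next
      let ?T = "S - insert v (nbrs E S v)"
      assume "reduced_homology_nonzero TYPE('k) (ind_complex E ?T) i"
      then have "has_matching E ?T i" using less.hyps[OF lt] less.prems(1) by blast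
      then show ?thesis unfolding Suc
        by (rule has_matching_add_edge[of E v w, rotated]) (use w v in \<open>auto simp: nbrs_iff\<close>)
    qed
  qed
qed

section \<open>Components that are 5-cycles\<close>

text \<open>Equating full neighbourhoods in \<open>S\<close> makes the cycle both chordless and a
  connected component of the graph on \<open>S\<close>.\<close>

definition c5_labelling :: "'a set set \<Rightarrow> 'a set \<Rightarrow> 'a set \<Rightarrow> 'a \<Rightarrow> 'a \<Rightarrow> 'a \<Rightarrow> 'a \<Rightarrow> 'a \<Rightarrow> bool" where
  "c5_labelling E S C a b c d e \<longleftrightarrow> distinct [a, b, c, d, e] \<and> C = {a, b, c, d, e} \<and> C \<subseteq> S \<and>
     nbrs E S a = {b, e} \<and> nbrs E S b = {a, c} \<and> nbrs E S c = {b, d} \<and>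
     nbrs E S d = {c, e} \<and> nbrs E S e = {d, a}"

definition c5_component :: "'a set set \<Rightarrow> 'a set \<Rightarrow> 'a set \<Rightarrow> bool" where
  "c5_component E S C \<longleftrightarrow> (\<exists>a b c d e. c5_labelling E S C a b c d e)"

lemma c5_labelling_rotate:
  "c5_labelling E S C a b c d e \<Longrightarrow> c5_labelling E S C b c d e a"
  by (auto simp: c5_labelling_def)

text \<open>The five rotations of a labelling start at the five vertices.\<close>

lemma c5_component_at:
  assumes "c5_component E S C" "a \<in> C"
  shows "\<exists>b c d e. c5_labelling E S C a b c d e"
proof -
  obtain p q r s t where P: "c5_labelling E S C p q r s t"
    using assms(1) unfolding c5_component_def by blast
  then have "a \<in> {p, q, r, s, t}" using assms(2) by (simp add: c5_labelling_def)
  moreover note P c5_labelling_rotate[OF P] c5_labelling_rotate[OF c5_labelling_rotate[OF P]]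
    c5_labelling_rotate[OF c5_labelling_rotate[OF c5_labelling_rotate[OF P]]]
    c5_labelling_rotate[OF c5_labelling_rotate[OF c5_labelling_rotate[OF c5_labelling_rotate[OF P]]]]
  ultimately show ?thesis by blast
qed

lemma c5_component_subset: "c5_component E S C \<Longrightarrow> C \<subseteq> S"
  by (auto simp: c5_component_def c5_labelling_def)

lemma c5_component_extend:
  assumes "c5_component E T C" "T \<subseteq> S" "\<And>x y. x \<in> S - T \<Longrightarrow> y \<in> C \<Longrightarrow> \<not> adj E x y"
  shows "c5_component E S C"
proof -
  have "nbrs E S y = nbrs E T y" if "y \<in> C" for y
    using assms(2) assms(3)[OF _ that] by (auto simp: nbrs_def adj_sym[of E y])
  then have "c5_labelling E S C a b c d e" if "c5_labelling E T C a b c d e" for a b c d e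
    using that assms(2) by (auto simp: c5_labelling_def)
  then show ?thesis using assms(1) unfolding c5_component_def by blast
qed

text \<open>Edges of the matching that meet \<open>C\<close> lie inside \<open>C\<close>, and five
  vertices carry at most two disjoint edges. For \<open>k < 2\<close> the truncated difference is
  0.\<close>

lemma has_matching_remove_c5:
  assumes E: "\<forall>e\<in>E. card e = 2" and C: "c5_component E T C" and "has_matching E T k"
  shows "has_matching E (T - C) (k - 2)"
proof -
  obtain M where M: "is_matching E M" "\<Union>M \<subseteq> T" "finite M" "card M = k"
    using assms(3) by (auto simp: has_matching_def)
  let ?A = "{e\<in>M. e \<inter> C = {}}" and ?B = "{e\<in>M. e \<inter> C \<noteq> {}}"
  have cC: "finite C" "card C = 5" using C by (auto simp: c5_component_def c5_labelling_def)
  have two: "card e = 2" if "e \<in> M" for e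
    using E M(1) that by (auto simp: is_matching_def)
  have clo: "q \<in> C" if "p \<in> C" "q \<in> T" "adj E p q" for p q
  proof -
    have "q \<in> nbrs E T p" using that by (simp add: nbrs_iff)
    then show ?thesis using c5_component_at[OF C that(1)] by (auto simp: c5_labelling_def)
  qed
  have "e \<subseteq> C" if "e \<in> ?B" for e
  proof
    fix q assume q: "q \<in> e"
    obtain p where p: "p \<in> e" "p \<in> C" using \<open>e \<in> ?B\<close> by auto
    show "q \<in> C"
    proof (cases "q = p")
      case False
      have "card e = 2" using \<open>e \<in> ?B\<close> two by simp
      then have "e = {p, q}" using p(1) q False by (auto simp: card_2_iff)
      then show ?thesis using clo[OF p(2), of q] q \<open>e \<in> ?B\<close> M(1,2) by (auto simp: adj_def is_matching_def)
    qed (use p in simp)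
  qed
  then have sub: "\<Union>?B \<subseteq> C" by blast
  have "card (\<Union>?B) = sum card ?B"
    using M(1) two by (intro card_Union_disjoint)
      (auto simp: is_matching_def pairwise_def disjnt_def intro: card_ge_0_finite)
  also have "\<dots> = card ?B * 2" using two by simp
  finally have "card ?B \<le> 2" using card_mono[OF cC(1) sub] cC(2) by simp
  moreover have "card M = card ?A + card ?B"
  proof -
    have "M = ?A \<union> ?B" by auto
    then show ?thesis using M(3) by (subst card_Un_disjoint[symmetric]) auto
  qed
  ultimately have "k - 2 \<le> card ?A" using M(4) by linarith
  moreover have "has_matching E (T - C) (card ?A)"
    unfolding has_matching_def
    using M by (intro exI[of _ ?A]) (auto simp: is_matching_def)
  ultimately show ?thesis using has_matching_mono by blast
qed

text \<open>The vertex \<open>y\<close> of the 5-cycle can be matched to \<open>x\<close>, and what is left of the cycle is a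
  path on four vertices, which has a perfect matching.\<close>

lemma has_matching_augment_c5:
  assumes E: "\<forall>e\<in>E. card e = 2" and C: "c5_component E T C" and m: "has_matching E T k"
    and x: "x \<notin> T" and y: "y \<in> C" "adj E x y"
  shows "has_matching E (insert x T) (Suc k)"
proof -
  obtain b c d e where c5: "distinct [y, b, c, d, e]" "C = {y, b, c, d, e}" "C \<subseteq> T"
     "nbrs E T b = {y, c}" "nbrs E T d = {c, e}"
    using c5_component_at[OF C y(1)] by (auto simp: c5_labelling_def)
  have bc: "adj E b c" and de: "adj E d e" using c5(4,5) by (auto simp: nbrs_def)
  have 0: "has_matching E (T - C) (k - 2)" by (rule has_matching_remove_c5[OF E C m])
  have 1: "has_matching E (T - C \<union> {x, y}) (Suc (k - 2))"
    by (rule has_matching_add_edge[OF y(2) 0]) (use x y in auto)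
  have 2: "has_matching E (T - C \<union> {x, y, b, c}) (Suc (Suc (k - 2)))"
    by (rule has_matching_add_edge[OF bc 1]) (use x c5 in auto)
  have 3: "has_matching E (insert x T) (Suc (Suc (Suc (k - 2))))"
    by (rule has_matching_add_edge[OF de 2]) (use x c5 in auto)
  \<comment> \<open>Truncation of \<open>k - 2\<close> only helps: the matching has at least
    \<open>Suc k\<close> edges.\<close>
  then show ?thesis by (rule has_matching_mono) auto
qed

section \<open>The combinatorial core\<close>

text \<open>This serves the case in which no vertex deletion preserves the homology. The homology
  enters only through \<open>noniso\<close>, \<open>hm\<close> and \<open>alt\<close>.\<close>

lemma induced_matching_or_c5_component_step:
  assumes E: "\<forall>e\<in>E. card e = 2" and ne: "S \<noteq> {}"
    and nomatch: "\<not> has_matching E S (Suc (Suc i))"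
    and noniso: "\<And>v. v \<in> S \<Longrightarrow> nbrs E S v \<noteq> {}"
    and hm: "\<And>v. v \<in> S \<Longrightarrow> has_matching E (S - insert v (nbrs E S v)) i"
    and alt: "\<And>v. v \<in> S \<Longrightarrow> has_induced_matching E (S - insert v (nbrs E S v)) i \<or>
      (\<exists>C. c5_component E (S - insert v (nbrs E S v)) C)"
  shows "has_induced_matching E S (Suc i) \<or> (\<exists>C. c5_component E S C)"
proof (rule ccontr)
  assume neg: "\<not> ?thesis"
  define T where "T v = S - insert v (nbrs E S v)" for v
  have Tiff: "u \<in> T v \<longleftrightarrow> u \<in> S \<and> u \<noteq> v \<and> \<not> adj E v u" for u v
    by (auto simp: T_def nbrs_iff)
  note irr = adj_irrefl[OF E]
  \<comment> \<open>As \<open>C\<close> is not a component of \<open>S\<close>, some neighbour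
    \<open>a\<close> of \<open>v\<close> is adjacent to \<open>C\<close>. Augmenting along
    \<open>a\<close> and adding the edge from \<open>v\<close> to a second neighbour
    \<open>b\<close> gives a matching of size \<open>i + 2\<close>.\<close>
  have c5: False if v: "v \<in> S" and C: "c5_component E (T v) C"
    and ab: "\<And>a. a \<in> S \<Longrightarrow> adj E v a \<Longrightarrow> (\<exists>y\<in>C. adj E a y) \<Longrightarrow> \<exists>b\<in>S. adj E v b \<and> b \<noteq> a" for v C
  proof -
    have sub: "C \<subseteq> T v" using C by (rule c5_component_subset)
    obtain a y where ay: "a \<in> S" "a \<notin> T v" "y \<in> C" "adj E a y"
      using neg c5_component_extend[OF C, of S] by (metis DiffD1 DiffD2 T_def Diff_subset)
    then have va: "adj E v a" using sub by (auto simp: Tiff)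
    then obtain b where b: "b \<in> S" "adj E v b" "b \<noteq> a" using ab ay by blast
    have "has_matching E (insert a (T v)) (Suc i)"
      using has_matching_augment_c5[OF E C _ ay(2-4)] hm[OF v] by (simp add: T_def)
    then have "has_matching E S (Suc (Suc i))"
      by (rule has_matching_add_edge[OF b(2)]) (use v b ay va irr in \<open>auto simp: Tiff\<close>)
    then show False using nomatch by simp
  qed
  \<comment> \<open>If \<open>N[v]\<close> were contained in \<open>N[w]\<close>, the edge
    \<open>v w\<close> would extend an induced matching of \<open>T w\<close>. If \<open>T w\<close>
    has a 5-cycle component instead, \<open>v\<close> has no neighbour on it and can act as the
    second neighbour of \<open>w\<close> in \<open>c5\<close>.\<close>
  have undominated: "\<exists>c\<in>S. adj E v c \<and> c \<noteq> w \<and> \<not> adj E w c"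
    if vw: "v \<in> S" "w \<in> S" "adj E v w" for v w
  proof (rule ccontr)
    assume dom: "\<not> ?thesis"
    have wv: "adj E w v" using vw adj_sym by metis
    have "S - (insert v (nbrs E S v) \<union> insert w (nbrs E S w)) = T w"
      using dom wv by (auto simp: nbrs_iff T_def)
    then have "\<not> has_induced_matching E (T w) i"
      using has_induced_matching_add_edge[OF E vw(3,1,2)] neg by metis
    then obtain C where C: "c5_component E (T w) C" using alt[OF vw(2)] by (auto simp: T_def)
    have "y \<in> S \<and> y \<noteq> w \<and> \<not> adj E w y" if "y \<in> C" for y
      using c5_component_subset[OF C] that by (auto simp: Tiff)
    then have "v \<noteq> a" if "\<exists>y\<in>C. adj E a y" for a using that dom by blast
    then show False using c5[OF vw(2) C] vw(1) wv by metis
  qed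
  \<comment> \<open>All degrees are at least two, so a neighbour can avoid any prescribed vertex
    \<open>z\<close>.\<close>
  have other: "\<exists>b\<in>S. adj E v b \<and> b \<noteq> z" if "v \<in> S" for v z
    using undominated[of v z] noniso[OF that] that by (auto simp: nbrs_def)
  \<comment> \<open>The edge \<open>a b\<close> and an edge from \<open>v\<close> to some
    \<open>c\<close> not adjacent to \<open>a\<close>, hence different from \<open>b\<close>,
    enlarge a matching of \<open>T v\<close> by two.\<close>
  have triangle_free: False if abc: "v \<in> S" "a \<in> S" "b \<in> S" "adj E v a" "adj E v b" "adj E a b" for v a b
  proof -
    obtain c where c: "c \<in> S" "adj E v c" "c \<noteq> a" "\<not> adj E a c" using undominated abc by blast
    have "has_matching E (T v \<union> {a, b}) (Suc i)"
      by (rule has_matching_add_edge[OF abc(6) hm[OF abc(1), folded T_def]]) (use abc in \<open>auto simp: Tiff\<close>)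
    then have "has_matching E S (Suc (Suc i))"
      by (rule has_matching_add_edge[OF c(2)]) (use abc c irr in \<open>auto simp: Tiff\<close>)
    then show False using nomatch by simp
  qed
  have pentagon: "\<exists>a b x y. distinct [v, a, x, y, b] \<and> {a, x, y, b} \<subseteq> S \<and> nbrs E S v = {a, b} \<and>
      adj E a x \<and> adj E x y \<and> adj E y b" if v: "v \<in> S" for v
  proof -
    \<comment> \<open>Since \<open>other\<close> supplies a second neighbour, \<open>c5\<close>
      excludes the 5-cycle alternative.\<close>
    have "has_induced_matching E (T v) i"
      using alt[OF v] c5[OF v] other[OF v] unfolding T_def by blast
    then obtain M where M: "is_induced_matching E M" "\<Union>M \<subseteq> T v" "finite M" "card M = i"
      by (auto simp: has_induced_matching_def)
    define X where "X = \<Union>M"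
    have X: "X \<subseteq> T v" "X \<subseteq> S" using M(2) by (auto simp: X_def T_def)
    have mX: "has_matching E X i"
      using M unfolding has_matching_def X_def is_induced_matching_def by blast
    have M_edge: "adj E p q \<and> p \<noteq> q" if "{p, q} \<in> M" for p q
      using that M(1) irr by (auto simp: is_induced_matching_def is_matching_def adj_def)
    have disj: "e \<inter> f = {}" if "e \<in> M" "f \<in> M" "e \<noteq> f" for e f
      using M(1) that by (simp add: is_induced_matching_def is_matching_def)
    have induced: "q \<in> e" if "p \<in> e" "e \<in> M" "q \<in> X" "adj E p q" for p q e
    proof -
      have "{p, q} \<in> M" using M(1) that by (auto simp: is_induced_matching_def X_def adj_def)
      moreover have "{p, q} \<inter> e \<noteq> {}" using that(1) by auto
      ultimately have "{p, q} = e" using disj that(2) by metis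
      then show ?thesis by auto
    qed
    \<comment> \<open>Along the augmenting path \<open>r x y z\<close> the edge \<open>x y\<close>
      is exchanged for \<open>r x\<close> and \<open>y z\<close>. The edge \<open>v b\<close> then
      brings the size to \<open>i + 2\<close>.\<close>
    have augment: False
      if xy: "{x, y} \<in> M" and r: "r \<in> S" "r \<notin> X" "adj E r x" and z: "z \<in> S" "z \<notin> X" "adj E y z"
        and "r \<noteq> z" and b: "b \<in> S" "adj E v b" "b \<noteq> r" "b \<noteq> z" for x y r z b
    proof -
      have xyX: "x \<in> X" "y \<in> X" "x \<noteq> y" using xy M_edge by (auto simp: X_def)
      have "r \<noteq> v" "z \<noteq> v" using xyX X(1) r z by (auto simp: Tiff adj_sym)
      have bX: "b \<notin> X" "v \<notin> X" using X(1) b by (auto simp: Tiff)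
      have i: "i = Suc (i - 1)" using xy M(3,4) by (cases i) auto
      have 0: "has_matching E (X - {x, y}) (i - 1)"
        unfolding has_matching_def
      proof (intro exI conjI)
        show "is_matching E (M - {{x, y}})"
          using M(1) by (auto simp: is_induced_matching_def is_matching_def)
        show "\<Union>(M - {{x, y}}) \<subseteq> X - {x, y}"
          using disj[OF _ xy] unfolding X_def by blast
      qed (use M xy in auto)
      have 1: "has_matching E (X - {y} \<union> {r}) (Suc (i - 1))"
        by (rule has_matching_add_edge[OF r(3) 0]) (use xyX r in auto)
      have 2: "has_matching E (X \<union> {r, z}) (Suc (Suc (i - 1)))"
        by (rule has_matching_add_edge[OF z(3) 1]) (use xyX r z \<open>r \<noteq> z\<close> in auto)
      have "has_matching E S (Suc (Suc (Suc (i - 1))))"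
        by (rule has_matching_add_edge[OF b(2) 2])
          (use X v b bX r z \<open>r \<noteq> v\<close> \<open>z \<noteq> v\<close> in auto)
      then show False using nomatch i by simp
    qed
    \<comment> \<open>An uncovered vertex \<open>r\<close> of \<open>T v\<close> has a neighbour
      \<open>x\<close>. If \<open>x\<close> is uncovered too, \<open>r x\<close> and
      \<open>v b\<close> enlarge \<open>M\<close> by two; otherwise \<open>r x\<close> starts an
      augmenting path, whose ends differ because there are no triangles.\<close>
    have TX: "T v \<subseteq> X"
    proof (rule ccontr)
      assume "\<not> T v \<subseteq> X"
      then obtain r where r: "r \<in> S" "r \<noteq> v" "\<not> adj E v r" "r \<notin> X"
        using Tiff by blast
      obtain x where x: "x \<in> S" "adj E r x" using other[OF r(1)] by blast
      have "x \<in> X"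
      proof (rule ccontr)
        assume xX: "x \<notin> X"
        obtain b where b: "b \<in> S" "adj E v b" "b \<noteq> x" using other[OF v] by blast
        have "x \<noteq> v" using x r adj_sym by metis
        have 1: "has_matching E (X \<union> {r, x}) (Suc i)"
          by (rule has_matching_add_edge[OF x(2) mX]) (use xX r in auto)
        have "has_matching E S (Suc (Suc i))"
          by (rule has_matching_add_edge[OF b(2) 1]) (use \<open>x \<noteq> v\<close> b x r v X in \<open>auto simp: Tiff\<close>)
        then show False using nomatch by simp
      qed
      then obtain e where e: "e \<in> M" "x \<in> e" by (auto simp: X_def)
      then have "card e = 2" using M(1) E by (auto simp: is_induced_matching_def is_matching_def)
      then obtain y where y: "e = {x, y}" using e(2) by (auto simp: card_2_iff)
      have yX: "y \<in> S" "adj E x y" "x \<noteq> y" using y e(1) M_edge[of x y] X(2) by (auto simp: X_def)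
      obtain z where z: "z \<in> S" "adj E y z" "z \<noteq> x" using other[OF yX(1)] by blast
      have "z \<notin> X" using induced[of y e z] y e(1) z irr by auto
      have "r \<noteq> z" using triangle_free[of x r y] x r yX z adj_sym by metis
      obtain b where b: "b \<in> S" "adj E v b" "b \<noteq> z" using other[OF v] by blast
      show False
        using augment[of x y r z b] e y r x z \<open>z \<notin> X\<close> \<open>r \<noteq> z\<close> b by auto
    qed
    \<comment> \<open>Otherwise \<open>S\<close> is the closed neighbourhood of \<open>v\<close>,
      and a second neighbour of some \<open>w\<close> adjacent to \<open>v\<close> closes a
      triangle.\<close>
    have "M \<noteq> {}"
    proof
      assume "M = {}"
      then have none: "T v = {}" using TX by (simp add: X_def)
      obtain w where w: "w \<in> S" "adj E v w" using other[OF v] by blast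
      obtain u where u: "u \<in> S" "adj E w u" "u \<noteq> v" using other[OF w(1)] by blast
      have "adj E v u" using none u Tiff by auto
      then show False using triangle_free[of v w u] v w u by blast
    qed
    then obtain e where e: "e \<in> M" by blast
    then have "card e = 2" using M(1) E by (auto simp: is_induced_matching_def is_matching_def)
    then obtain x y where xy: "e = {x, y}" by (auto simp: card_2_iff)
    have xyX: "x \<in> X" "y \<in> X" "adj E x y" "x \<noteq> y"
      using xy e M_edge[of x y] by (auto simp: X_def)
    then have xyS: "x \<in> S" "y \<in> S" "x \<noteq> v" "y \<noteq> v" "\<not> adj E v x" "\<not> adj E v y"
      using X by (auto simp: Tiff)
    \<comment> \<open>As \<open>M\<close> is induced and covers \<open>T v\<close>, an edge leaving
      \<open>e\<close> can only end in a neighbour of \<open>v\<close>.\<close>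
    have leave: "a \<notin> X \<and> adj E v a" if "p \<in> e" "a \<in> S" "adj E p a" "a \<notin> e" for p a
    proof -
      have "a \<notin> X" using induced e that by blast
      moreover have "a \<noteq> v" using that xy xyS adj_sym by (metis insertE singletonD)
      ultimately show ?thesis using TX that(2) by (auto simp: Tiff)
    qed
    obtain a where a: "a \<in> S" "adj E x a" "a \<noteq> y" using other[OF xyS(1)] by blast
    obtain b where b: "b \<in> S" "adj E y b" "b \<noteq> x" using other[OF xyS(2)] by blast
    have a': "a \<notin> X" "adj E v a" using leave[of x a] a xy irr by auto
    have b': "b \<notin> X" "adj E v b" using leave[of y b] b xy irr by auto
    have ax: "adj E a x" using a(2) adj_sym by metis
    have "a \<noteq> b" using triangle_free[of x y a] xyS xyX a b by auto
    \<comment> \<open>A third neighbour \<open>c\<close> of \<open>v\<close> could be matched to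
      \<open>v\<close> while \<open>a x y b\<close> serves as augmenting path.\<close>
    have "c \<in> {a, b}" if "c \<in> S" "adj E v c" for c
      using augment[of x y a b c] e xy a(1) a'(1) ax b(1,2) b'(1) \<open>a \<noteq> b\<close> that by auto
    then have "nbrs E S v = {a, b}" using a(1) a'(2) b(1) b'(2) unfolding nbrs_def by blast
    moreover have "distinct [v, a, x, y, b]"
      using xyS xyX a b a' b' \<open>a \<noteq> b\<close> irr by auto
    moreover have "{a, x, y, b} \<subseteq> S" using a(1) b(1) xyS(1,2) by simp
    ultimately show ?thesis using ax xyX(3) b(2) by blast
  qed
  \<comment> \<open>By \<open>pentagon\<close> every degree is two, so two distinct neighbours are
    all of them. This turns the pentagon at a single vertex into a component.\<close>
  have two: "nbrs E S u = {p, q}" if "u \<in> S" "p \<in> S" "q \<in> S" "p \<noteq> q" "adj E u p" "adj E u q" for u p q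
  proof -
    obtain a b where "nbrs E S u = {a, b}" using pentagon[OF \<open>u \<in> S\<close>] by blast
    moreover have "p \<in> nbrs E S u" "q \<in> nbrs E S u" using that by (auto simp: nbrs_iff)
    ultimately show ?thesis using that(4) by auto
  qed
  obtain v where v: "v \<in> S" using ne by blast
  then obtain a b x y where p: "distinct [v, a, x, y, b]" "{a, x, y, b} \<subseteq> S" "nbrs E S v = {a, b}"
      "adj E a x" "adj E x y" "adj E y b" using pentagon by blast
  then have "adj E v a" "adj E v b" by (auto simp: nbrs_def)
  moreover from this have "adj E a v" "adj E b v" "adj E x a" "adj E y x" "adj E b y"
    using p by (simp_all add: adj_sym)
  ultimately have "nbrs E S a = {v, x}" "nbrs E S x = {a, y}" "nbrs E S y = {x, b}" "nbrs E S b = {y, v}"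
    using p v two by auto
  then have "c5_labelling E S {v, a, x, y, b} v a x y b"
    using p(1-3) v by (simp add: c5_labelling_def)
  then show False using neg unfolding c5_component_def by blast
qed

section \<open>Induction on the vertex set\<close>

text \<open>A vertex outside \<open>T\<close> adjacent to \<open>C\<close> would augment the
  matching of size \<open>j\<close> to a forbidden one.\<close>

lemma c5_component_extend_maximum:
  assumes E: "\<forall>e\<in>E. card e = 2" and "c5_component E T C" "T \<subseteq> S"
    and "has_matching E T j" "\<not> has_matching E S (Suc j)"
  shows "c5_component E S C"
proof (rule c5_component_extend[OF assms(2,3)])
  fix x y assume "x \<in> S - T" "y \<in> C"
  then show "\<not> adj E x y"
    using has_matching_augment_c5[OF E assms(2,4), of x y] assms(3,5)
    by (metis Diff_iff has_matching_mono insert_subset order_refl)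
qed

lemma reduced_homology_imp_induced_matching_or_c5:
  fixes S :: "'a::linorder set"
  assumes E: "\<forall>e\<in>E. card e = 2"
  shows "finite S \<Longrightarrow> reduced_homology_nonzero TYPE('k::field) (ind_complex E S) j \<Longrightarrow>
    \<not> has_matching E S (Suc j) \<Longrightarrow> has_induced_matching E S j \<or> (\<exists>C. c5_component E S C)"
proof (induction "card S" arbitrary: S j rule: less_induct)
  case less
  show ?case
  proof (cases j)
    case 0
    have "is_induced_matching E {}"
      using E by (auto simp: is_induced_matching_def is_matching_def)
    then show ?thesis using 0 by (auto simp: has_induced_matching_def intro!: exI[of _ "{}"])
  next
    case (Suc i)
    have ne: "S \<noteq> {}"
    proof
      assume "S = {}"
      moreover have "has_matching E S (Suc i)"
        using reduced_homology_imp_matching[OF E less.prems(1,2)] Suc by simp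
      ultimately show False using has_matching_empty[OF E] by blast
    qed
    have lt: "card (S - insert v A) < card S" if "v \<in> S" for A v
      using less.prems(1) that by (intro psubset_card_mono) auto
    show ?thesis
    proof (cases "\<exists>v\<in>S. reduced_homology_nonzero TYPE('k) (ind_complex E (S - {v})) j")
      case True
      then obtain v where v: "v \<in> S" "reduced_homology_nonzero TYPE('k) (ind_complex E (S - {v})) j"
        by blast
      have fin: "finite (S - {v})" using less.prems(1) by simp
      have "\<not> has_matching E (S - {v}) (Suc j)"
        using less.prems(3) has_matching_mono by blast
      then have "has_induced_matching E (S - {v}) j \<or> (\<exists>C. c5_component E (S - {v}) C)"
        using less.hyps[OF lt[OF v(1)] fin v(2)] by blast
      then show ?thesis
        using has_induced_matching_mono[of E "S - {v}" j S] less.prems(3)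
          c5_component_extend_maximum[OF E, of "S - {v}" _ S j]
          reduced_homology_imp_matching[OF E fin v(2)] by blast
    next
      case False
      have link: "reduced_homology_nonzero TYPE('k) (ind_complex E (S - insert v (nbrs E S v))) i"
        if "v \<in> S" for v
        using reduced_homology_deletion_or_link[OF E less.prems(1) that] less.prems(2) False that Suc
        by blast
      have noniso: "nbrs E S v \<noteq> {}" if "v \<in> S" for v
        using reduced_homology_isolated_vertex[OF E less.prems(1) that] less.prems(2) by blast
      \<comment> \<open>An edge at \<open>v\<close> is disjoint from the link's vertex set, so the
        matching bound drops along with the degree, as the induction hypothesis requires.\<close>
      have nomatch: "\<not> has_matching E (S - insert v (nbrs E S v)) (Suc i)" if v: "v \<in> S" for v
      proof
        assume *: "has_matching E (S - insert v (nbrs E S v)) (Suc i)"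
        obtain w where w: "w \<in> nbrs E S v" using noniso[OF v] by blast
        have "has_matching E S (Suc (Suc i))"
          by (rule has_matching_add_edge[of E v w, OF _ *]) (use w v in \<open>auto simp: nbrs_iff\<close>)
        then show False using less.prems(3) Suc by simp
      qed
      have fin: "finite (S - A)" for A using less.prems(1) by simp
      show ?thesis unfolding Suc
      proof (rule induced_matching_or_c5_component_step[OF E ne])
        show "\<not> has_matching E S (Suc (Suc i))" using less.prems(3) Suc by simp
      next
        fix v assume v: "v \<in> S"
        show "nbrs E S v \<noteq> {}" by (rule noniso[OF v])
        show "has_matching E (S - insert v (nbrs E S v)) i"
          by (rule reduced_homology_imp_matching[OF E fin link[OF v]])
        show "has_induced_matching E (S - insert v (nbrs E S v)) i \<or>
          (\<exists>C. c5_component E (S - insert v (nbrs E S v)) C)"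
          by (rule less.hyps[OF lt[OF v] fin link[OF v] nomatch[OF v]])
      qed
    qed
  qed
qed

section \<open>Connected graphs and the conclusion\<close>

text \<open>\<open>C\<close> is closed under taking neighbours, so every walk from \<open>a\<close>
  stays in it and \<open>C\<close> is all of \<open>V\<close>.\<close>

lemma connected_c5_component:
  assumes "connected_graph V E" "c5_component E V C"
  shows "iso_C5 V E"
proof -
  obtain a b c d e where c5: "distinct [a, b, c, d, e]" "C = {a, b, c, d, e}" "C \<subseteq> V"
     "nbrs E V a = {b, e}" "nbrs E V b = {a, c}" "nbrs E V c = {b, d}"
     "nbrs E V d = {c, e}" "nbrs E V e = {d, a}"
    using assms(2) unfolding c5_component_def c5_labelling_def by (elim exE conjE) (rule that)
  have "u \<in> C" if "u \<in> V" for u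
  proof -
    have "(\<lambda>x y. x \<in> V \<and> y \<in> V \<and> adj E x y)\<^sup>*\<^sup>* a u"
      using assms(1) c5(2,3) that unfolding connected_graph_def by blast
    then show ?thesis
    proof (induction rule: rtranclp_induct)
      case base
      then show ?case using c5(2) by simp
    next
      case (step x y)
      then have "y \<in> nbrs E V x" by (simp add: nbrs_iff)
      then show ?case using step.IH c5 by auto
    qed
  qed
  then have V: "V = {a, b, c, d, e}" using c5(2,3) by auto
  define f :: "'a \<Rightarrow> nat" where
    "f x = (if x = a then 0 else if x = b then 1 else if x = c then 2 else if x = d then 3 else 4)" for x
  have f: "f a = 0" "f b = 1" "f c = 2" "f d = 3" "f e = 4" using c5(1) by (auto simp: f_def)
  have "{0..<5} = {0, 1, 2, 3, 4::nat}" by auto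
  then have "bij_betw f V {0..<5}"
    unfolding bij_betw_def inj_on_def V by (simp add: f)
  moreover have "\<forall>u\<in>{a, b, c, d, e}. \<forall>w\<in>{a, b, c, d, e}.
      w \<in> nbrs E V u \<longleftrightarrow> (f w = (f u + 1) mod 5 \<or> f u = (f w + 1) mod 5)"
    \<comment> \<open>The reversed list supplies the inequalities between the vertices in the other
      orientation for rewriting.\<close>
    using c5(1) c5(1)[THEN distinct_rev[THEN iffD2]] by (simp add: f c5(4-8))
  then have "\<forall>u\<in>V. \<forall>w\<in>V. {u, w} \<in> E \<longleftrightarrow> (f w = (f u + 1) mod 5 \<or> f u = (f w + 1) mod 5)"
    unfolding V[symmetric] by (simp add: nbrs_iff adj_def)
  ultimately show ?thesis unfolding iso_C5_def by blast
qed

theorem mainTheorem7: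
  fixes V :: "'a::linorder set" and E :: "'a set set"
  assumes "simple_graph V E"
    and "connected_graph V E"
    and "induced_matching_number E < reg TYPE('k::field) V E"
    and "reg TYPE('k::field) V E = matching_number E"
  shows "iso_C5 V E"
proof -
  define j where "j = reg TYPE('k) V E"
  have finV: "finite V" and E: "\<forall>e\<in>E. card e = 2" and EV: "\<Union>E \<subseteq> V"
    using assms(1) by (auto simp: simple_graph_def)
  have "finite E" using finV EV by (metis finite_UnionD finite_subset)
  then have fin: "finite {M. is_matching E M}" "finite {M. is_induced_matching E M}"
    by (rule finite_subset[rotated, OF finite_Pow_iff[THEN iffD2]];
        auto simp: is_matching_def is_induced_matching_def)+
  have matching_le: "k \<le> matching_number E" if "has_matching E S k" for S k
    using that fin(1) unfolding has_matching_def matching_number_def by (auto intro!: Max_ge)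
  let ?J = "{k. \<exists>S\<subseteq>V. reduced_homology_nonzero TYPE('k) (ind_complex E S) k}"
  have "?J \<subseteq> {..matching_number E}"
    using reduced_homology_imp_matching[OF E] matching_le finV finite_subset by blast
  then have "finite ?J" by (rule finite_subset) simp
  \<comment> \<open>The complex whose only face is empty has nonzero reduced homology in degree -1.
    Hence the maximum defining \<open>reg\<close> is taken over a nonempty finite set and is
    attained.\<close>
  moreover have "0 \<in> ?J"
  proof -
    have empty: "{} \<in> ind_complex E {}" using E by (auto simp: ind_complex_def)
    have "is_chain (ind_complex E {}) 0 (\<lambda>\<sigma>. if \<sigma> = {} then 1 else 0 :: 'k)"
      using empty by (simp add: is_chain_def)
    then have "reduced_homology_nonzero TYPE('k) (ind_complex E {}) 0"
      unfolding reduced_homology_ind_complex_iff[OF finite.emptyI]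
      by (intro exI[of _ "\<lambda>\<sigma>. if \<sigma> = {} then 1 else 0"]) (simp add: bdry_def)
    then show ?thesis by blast
  qed
  ultimately have "j \<in> ?J" unfolding j_def reg_def using Max_in by blast
  then obtain S where S: "S \<subseteq> V" "reduced_homology_nonzero TYPE('k) (ind_complex E S) j" by blast
  have finS: "finite S" using S finV finite_subset by blast
  \<comment> \<open>Here the equality of regularity and matching number enters: \<open>j\<close>
    bounds all matchings, whatever vertex set contains them.\<close>
  have nomatch: "\<not> has_matching E A (Suc j)" for A
    using matching_le[of A "Suc j"] assms(4) by (auto simp: j_def)
  have "\<not> has_induced_matching E S j"
  proof
    assume "has_induced_matching E S j"
    then have "j \<le> induced_matching_number E"
      using fin(2) unfolding has_induced_matching_def induced_matching_number_def
      by (auto intro!: Max_ge)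
    then show False using assms(3) by (simp add: j_def)
  qed
  then obtain C where "c5_component E S C"
    using reduced_homology_imp_induced_matching_or_c5[OF E finS S(2) nomatch] by blast
  \<comment> \<open>The homology on \<open>S\<close> forces a matching of size \<open>j\<close>
    inside \<open>S\<close>, which is already maximum in the whole graph.\<close>
  then have "c5_component E V C"
    using c5_component_extend_maximum[OF E _ S(1) _ nomatch]
      reduced_homology_imp_matching[OF E finS S(2)] by blast
  then show ?thesis by (rule connected_c5_component[OF assms(2)])
qed

end
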